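(* There is an absolute constant $C>0$ such that the following holds. Let $x\in\mathbb{R}^N$. For a given accuracy $\epsilon\in(0,1/2]$, confidence $\xi\in(0,1)$, and number $p$ of estimates $\hat x_1,\dots,\hat x_p\in\mathbb{R}^N$, it suffices to allocate $r=\lceil C\epsilon^{-2}\log\frac{p}{2\xi}\rceil$ rows to a cross validation matrix $\Psi$ of Gaussian or Bernoulli type (an $r\times N$ random matrix normalized as in the context), independent of the estimates $\hat x_j$, to obtain with probability greater than or equal to $1-\xi$, for each $j=1,\dots,p$, the bounds $$\frac{1}{1+\epsilon}\le\frac{\|x-\hat x_j\|_{\ell_2^N}}{\|\Psi(x-\hat x_j)\|_{\ell_2^r}}\le\frac1{1-\epsilon}$$ and $$\frac{1-3\epsilon}{(1+\epsilon)(1-\epsilon)^2}\le\frac{\|x-\hat x_j\|_{\ell_2^N}/\|x\|_{\ell_2^N}}{\|\Psi(x-\hat x_j)\|_{\ell_2^r}/\|\Psi x\|_{\ell_2^r}}\le\frac{1}{(1-\epsilon)^2},$$ and also $$\frac1{1+\epsilon}\le\frac{\eta_{or}}{\widehat{\eta_{cv}}}\le\frac1{1-\epsilon},$$ where $\eta_{or}=\min_{1\le j\le p}\|x-\hat x_j\|_{\ell_2^N}$ and $\widehat{\eta_{cv}}=\min_{1\le j\le p}\|\Psi(x-\hat x_j)\|_{\ell_2^r}$.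
   Context: $\ell_2^k$ denotes the Euclidean norm on $\mathbb{R}^k$. A Gaussian (resp. Bernoulli) type $r\times N$ matrix $\Psi$ has entries that are independent realizations of a random variable $R$ which is centered Gaussian with variance $1/r$ (resp. takes the values $\pm1/\sqrt r$ with probability $1/2$ each); so $\mathbb{E}R=0$ and $\mathrm{Var}\,R=1/r$. The vectors $x,\hat x_1,\dots,\hat x_p$ are fixed independently of $\Psi$. Ratios are understood for those quantities for which the denominators are meaningful ($x\neq0$, $x\ne\hat x_j$).
   Formalization: As stated this fails when p/(2ξ) is at most 1 or close to 1 (p=1 or 2), where r is 0 or too small. What is proved: for each κ>1 there is C depending only on κ that works whenever p/(2ξ) ≥ κ; κ=3/2 gives one absolute C for all p≥3 and all ξ in (0,1). *)

theory Defs
  imports "HOL-Probability.Probability" "Jordan_Normal_Form.Matrix"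
begin

definition l2norm :: "real vec \<Rightarrow> real" where
  "l2norm v = L2_set (vec_index v) {..<dim_vec v}"

text \<open>The second parameter of \<^const>\<open>normal_density\<close> is the standard deviation, so the entries
  have variance \<open>1 / r\<close>.\<close>

definition gaussian_entry :: "nat \<Rightarrow> real measure" where
  "gaussian_entry r = density lborel (normal_density 0 (1 / sqrt (real r)))"

definition bernoulli_entry :: "nat \<Rightarrow> real measure" where
  "bernoulli_entry r =
     distr (measure_pmf (bernoulli_pmf (1 / 2))) borel (\<lambda>b. (if b then 1 else - 1) / sqrt (real r))"

text \<open>The joint law of the entries of an \<open>r \<times> N\<close> matrix with independent entries of law \<open>\<nu>\<close>. A sample
  point \<open>\<omega>\<close> is a function on index pairs, and \<open>mat r N \<omega>\<close> is the matrix itself. Working with the law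
  instead of random variables on an arbitrary probability space keeps constants independent of the
  type of the sample space.\<close>

definition iid_entries :: "nat \<Rightarrow> nat \<Rightarrow> real measure \<Rightarrow> (nat \<times> nat \<Rightarrow> real) measure" where
  "iid_entries r N \<nu> = PiM ({..<r} \<times> {..<N}) (\<lambda>_. \<nu>)"

text \<open>A two-sided bound on the quotient \<open>a / b\<close>, counted as violated when \<open>b = 0\<close>. If \<open>b\<close> is itself
  a quotient \<open>c / d\<close>, then \<open>b \<noteq> 0\<close> also forces \<open>d \<noteq> 0\<close>, since \<open>c / 0 = 0\<close>.\<close>

definition ratio_between :: "real \<Rightarrow> real \<Rightarrow> real \<Rightarrow> real \<Rightarrow> bool" where
  "ratio_between lo a b hi \<longleftrightarrow> b \<noteq> 0 \<and> lo \<le> a / b \<and> a / b \<le> hi"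

definition eta_or :: "nat \<Rightarrow> real vec \<Rightarrow> (nat \<Rightarrow> real vec) \<Rightarrow> real" where
  "eta_or p x xhat = Min ((\<lambda>j. l2norm (x - xhat j)) ` {1..p})"

definition eta_cv :: "real mat \<Rightarrow> nat \<Rightarrow> real vec \<Rightarrow> (nat \<Rightarrow> real vec) \<Rightarrow> real" where
  "eta_cv \<Psi> p x xhat = Min ((\<lambda>j. l2norm (\<Psi> *\<^sub>v (x - xhat j))) ` {1..p})"

text \<open>The simultaneous bounds. Each one is imposed whenever the deterministic denominators and the
  quantity being estimated are nonzero. For the last one this means that no estimate is exact: otherwise
  both minima vanish.\<close>

definition cv_bounds ::
    "real \<Rightarrow> real mat \<Rightarrow> nat \<Rightarrow> real vec \<Rightarrow> (nat \<Rightarrow> real vec) \<Rightarrow> bool" where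
  "cv_bounds \<epsilon> \<Psi> p x xhat \<longleftrightarrow>
     (\<forall>j\<in>{1..p}. x \<noteq> xhat j \<longrightarrow>
        ratio_between (1 / (1 + \<epsilon>))
          (l2norm (x - xhat j)) (l2norm (\<Psi> *\<^sub>v (x - xhat j)))
          (1 / (1 - \<epsilon>))) \<and>
     (\<forall>j\<in>{1..p}. x \<noteq> 0\<^sub>v (dim_vec x) \<and> x \<noteq> xhat j \<longrightarrow>
        ratio_between ((1 - 3 * \<epsilon>) / ((1 + \<epsilon>) * (1 - \<epsilon>)\<^sup>2))
          (l2norm (x - xhat j) / l2norm x)
          (l2norm (\<Psi> *\<^sub>v (x - xhat j)) / l2norm (\<Psi> *\<^sub>v x))
          (1 / (1 - \<epsilon>)\<^sup>2)) \<and>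
     ((\<forall>j\<in>{1..p}. x \<noteq> xhat j) \<longrightarrow>
        ratio_between (1 / (1 + \<epsilon>)) (eta_or p x xhat) (eta_cv \<Psi> p x xhat) (1 / (1 - \<epsilon>)))"

end

theory Submission
  imports Defs
begin

text \<open>
  All three families of bounds follow once \<open>\<Psi>\<close> preserves the norms of the \<open>p + 1\<close> fixed
  vectors \<open>x\<close>, \<open>x - xhat j\<close> up to factors \<open>1 \<plusminus> \<epsilon>\<close>. For a single vector \<open>v\<close>, the normalized row products
  \<open>Z i = sqrt r * (\<Psi> v) i / \<parallel>v\<parallel>\<close> are independent, have variance \<open>1\<close>, and their moment generating functions
  are at most \<open>exp (s\<^sup>2 / 2)\<close>, both for Gaussian and for Bernoulli entries. This yields
  \<open>E exp (l Z\<^sup>2) \<le> exp (l + 128 l\<^sup>2)\<close> for small \<open>l\<close> of either sign, and Chernoff's method bounds the failure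
  probability by \<open>2 exp (- r \<epsilon>\<^sup>2 / 512)\<close>. A union bound over at most \<open>2 p\<close> vectors then leaves
  \<open>4 p exp (- r \<epsilon>\<^sup>2 / 512)\<close>. With \<open>L = p / (2 \<xi>)\<close> this is at most \<open>\<xi>\<close> as soon as
  \<open>r \<epsilon>\<^sup>2 \<ge> 512 ln (8 L)\<close>, and \<open>ln 8 \<le> (ln 8 / ln \<kappa>) ln L\<close> absorbs the constant into \<open>C\<close>.
\<close>

subsection \<open>Strictly sub-Gaussian random variables\<close>

text \<open>The proxy \<open>v\<close> is also the exact variance: the linear term in the expansion
  of \<open>exp (l * Z^2)\<close> has to average to exactly \<open>l\<close>, and a mere upper bound
  on the variance would fail for negative \<open>l\<close>. Nonnegative integrals spare the
  exponential bound any integrability side condition.\<close>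

definition strict_subgaussian :: "real \<Rightarrow> 'a measure \<Rightarrow> ('a \<Rightarrow> real) \<Rightarrow> bool" where
  "strict_subgaussian v M X \<longleftrightarrow>
     (\<forall>s. (\<integral>\<^sup>+\<omega>. ennreal (exp (s * X \<omega>)) \<partial>M) \<le> ennreal (exp (v * s\<^sup>2 / 2))) \<and>
     has_bochner_integral M X 0 \<and> has_bochner_integral M (\<lambda>\<omega>. (X \<omega>)\<^sup>2) v"

lemma strict_subgaussian_measurable:
  "strict_subgaussian v M X \<Longrightarrow> X \<in> borel_measurable M"
  by (auto simp: strict_subgaussian_def has_bochner_integral_iff)

lemma (in prob_space) has_bochner_integral_mult_of_indep_vars:
  fixes X :: "'i \<Rightarrow> 'a \<Rightarrow> real"
  assumes "indep_vars (\<lambda>_. borel) X I" "i \<in> I" "j \<in> I" "i \<noteq> j"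
    and "integrable M (X i)" "integrable M (X j)"
  shows "has_bochner_integral M (\<lambda>\<omega>. X i \<omega> * X j \<omega>) (expectation (X i) * expectation (X j))"
proof -
  have ind: "indep_vars (\<lambda>_. borel) X {i, j}"
    by (rule indep_vars_subset[OF assms(1)]) (use assms in auto)
  have int: "integrable M (X k)" if "k \<in> {i, j}" for k
    using that assms by auto
  show ?thesis
    using indep_vars_lebesgue_integral[OF _ ind int] indep_vars_integrable[OF _ ind int] assms(4)
    by (simp add: has_bochner_integral_iff)
qed

text \<open>Independence factors the exponential moment, so the proxies add. The same number remains
  the exact variance because centered independent variables are uncorrelated, which leaves only the
  diagonal of the expanded square.\<close>

lemma (in prob_space) strict_subgaussian_sum:
  fixes X :: "'i \<Rightarrow> 'a \<Rightarrow> real"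
  assumes I: "finite I" and ind: "indep_vars (\<lambda>_. borel) X I"
    and X: "\<And>i. i \<in> I \<Longrightarrow> strict_subgaussian v M (X i)"
  shows "strict_subgaussian (v * (\<Sum>i\<in>I. (u i)\<^sup>2)) M (\<lambda>\<omega>. \<Sum>i\<in>I. u i * X i \<omega>)"
  unfolding strict_subgaussian_def
proof (intro conjI allI)
  have mean: "has_bochner_integral M (X i) 0" if "i \<in> I" for i
    using X[OF that] by (simp add: strict_subgaussian_def)
  fix s :: real
  have "indep_vars (\<lambda>_. borel) (\<lambda>i \<omega>. ennreal (exp (s * (u i * X i \<omega>)))) I"
    by (rule indep_vars_compose2[OF ind, where Y = "\<lambda>i x. ennreal (exp (s * (u i * x)))"]) measurable
  then have "(\<integral>\<^sup>+\<omega>. (\<Prod>i\<in>I. ennreal (exp (s * (u i * X i \<omega>)))) \<partial>M) =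
      (\<Prod>i\<in>I. \<integral>\<^sup>+\<omega>. ennreal (exp (s * (u i * X i \<omega>))) \<partial>M)"
    by (rule indep_vars_nn_integral[OF I]) simp
  also have "\<dots> \<le> (\<Prod>i\<in>I. ennreal (exp (v * (s * u i)\<^sup>2 / 2)))"
  proof (rule prod_mono_ennreal)
    fix i assume "i \<in> I"
    then have "(\<integral>\<^sup>+\<omega>. ennreal (exp ((s * u i) * X i \<omega>)) \<partial>M) \<le> ennreal (exp (v * (s * u i)\<^sup>2 / 2))"
      using X unfolding strict_subgaussian_def by blast
    then show "(\<integral>\<^sup>+\<omega>. ennreal (exp (s * (u i * X i \<omega>))) \<partial>M) \<le> ennreal (exp (v * (s * u i)\<^sup>2 / 2))"
      by (simp add: mult.assoc)
  qed
  finally show "(\<integral>\<^sup>+\<omega>. ennreal (exp (s * (\<Sum>i\<in>I. u i * X i \<omega>))) \<partial>M)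
      \<le> ennreal (exp (v * (\<Sum>i\<in>I. (u i)\<^sup>2) * s\<^sup>2 / 2))"
    by (simp add: prod_ennreal exp_sum[OF I, symmetric] sum_distrib_left sum_distrib_right
        sum_divide_distrib power_mult_distrib mult_ac)
next
  have "has_bochner_integral M (\<lambda>\<omega>. \<Sum>i\<in>I. u i * X i \<omega>) (\<Sum>i\<in>I. u i * 0)"
    using X by (intro has_bochner_integral_sum has_bochner_integral_mult_right)
      (auto simp: strict_subgaussian_def)
  then show "has_bochner_integral M (\<lambda>\<omega>. \<Sum>i\<in>I. u i * X i \<omega>) 0" by simp
next
  have E: "has_bochner_integral M (\<lambda>\<omega>. X i \<omega> * X j \<omega>) (if i = j then v else 0)"
    if ij: "i \<in> I" "j \<in> I" for i j
  proof (cases "i = j")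
    case True
    then show ?thesis
      using X[OF ij(1)] by (simp add: strict_subgaussian_def power2_eq_square)
  next
    case False
    have "has_bochner_integral M (X i) 0" "has_bochner_integral M (X j) 0"
      using X ij by (auto simp: strict_subgaussian_def)
    then show ?thesis
      using has_bochner_integral_mult_of_indep_vars[OF ind ij False] False
      by (simp add: has_bochner_integral_iff)
  qed
  have "has_bochner_integral M (\<lambda>\<omega>. \<Sum>i\<in>I. \<Sum>j\<in>I. u i * u j * (X i \<omega> * X j \<omega>))
      (\<Sum>i\<in>I. \<Sum>j\<in>I. u i * u j * (if i = j then v else 0))"
    by (intro has_bochner_integral_sum has_bochner_integral_mult_right E)
  moreover have "(\<Sum>i\<in>I. \<Sum>j\<in>I. u i * u j * (if i = j then v else 0)) = v * (\<Sum>i\<in>I. (u i)\<^sup>2)"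
    using I by (simp add: if_distrib[of "(*) _"] sum_distrib_left power2_eq_square mult_ac cong: if_cong)
  moreover have "(\<lambda>\<omega>. \<Sum>i\<in>I. \<Sum>j\<in>I. u i * u j * (X i \<omega> * X j \<omega>)) = (\<lambda>\<omega>. (\<Sum>i\<in>I. u i * X i \<omega>)\<^sup>2)"
    by (simp add: fun_eq_iff power2_eq_square sum_product mult_ac)
  ultimately show "has_bochner_integral M (\<lambda>\<omega>. (\<Sum>i\<in>I. u i * X i \<omega>)\<^sup>2) (v * (\<Sum>i\<in>I. (u i)\<^sup>2))"
    by simp
qed

section \<open>Gaussian integrals and exponential moments of squares\<close>

text \<open>Completing the square: the tilted density is a constant times the normal density with
  mean \<open>\<sigma>^2 * s\<close>, which has total mass one.\<close>

lemma nn_integral_exp_normal_density: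
  assumes "0 < \<sigma>"
  shows "(\<integral>\<^sup>+x. ennreal (normal_density 0 \<sigma> x * exp (s * x)) \<partial>lborel) = ennreal (exp (\<sigma>\<^sup>2 * s\<^sup>2 / 2))"
proof -
  have "normal_density 0 \<sigma> x * exp (s * x) = exp (\<sigma>\<^sup>2 * s\<^sup>2 / 2) * normal_density (\<sigma>\<^sup>2 * s) \<sigma> x" for x
  proof -
    have "- x\<^sup>2 / (2 * \<sigma>\<^sup>2) + s * x = \<sigma>\<^sup>2 * s\<^sup>2 / 2 + - (x - \<sigma>\<^sup>2 * s)\<^sup>2 / (2 * \<sigma>\<^sup>2)"
      using assms by (simp add: field_simps power2_eq_square)
    then have "exp (- x\<^sup>2 / (2 * \<sigma>\<^sup>2)) * exp (s * x) =
        exp (\<sigma>\<^sup>2 * s\<^sup>2 / 2) * exp (- (x - \<sigma>\<^sup>2 * s)\<^sup>2 / (2 * \<sigma>\<^sup>2))"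
      by (metis exp_add)
    then show ?thesis by (simp add: normal_density_def)
  qed
  then show ?thesis
    using assms by (simp add: ennreal_mult' nn_integral_cmult nn_integral_eq_integral)
qed

text \<open>The extra factor halves the Gaussian exponent, leaving \<open>sqrt 2\<close> times the
  density of standard deviation \<open>sqrt 2\<close>.\<close>

lemma nn_integral_normal_density_exp_square:
  "(\<integral>\<^sup>+x. ennreal (std_normal_density x * exp (x\<^sup>2 / 4)) \<partial>lborel) = ennreal (sqrt 2)"
proof -
  have "std_normal_density x * exp (x\<^sup>2 / 4) = sqrt 2 * normal_density 0 (sqrt 2) x" for x
  proof -
    have "exp (- x\<^sup>2 / 2) * exp (x\<^sup>2 / 4) = exp (- x\<^sup>2 / 4)"
      by (simp flip: exp_add)
    then show ?thesis
      by (simp add: normal_density_def real_sqrt_mult field_simps)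
  qed
  then show ?thesis
    by (simp add: ennreal_mult' nn_integral_cmult nn_integral_eq_integral)
qed

text \<open>Linearization: \<open>exp (z\<^sup>2 / 4)\<close> is the Gaussian average of \<open>exp (g z / sqrt 2)\<close>, so Fubini turns
  the bound on the moment generating function into an exponential bound for the square.\<close>

lemma (in prob_space) nn_integral_exp_square_le:
  assumes "strict_subgaussian 1 M Z"
  shows "(\<integral>\<^sup>+\<omega>. ennreal (exp ((Z \<omega>)\<^sup>2 / 4)) \<partial>M) \<le> 2"
proof -
  note [measurable] = strict_subgaussian_measurable[OF assms]
  interpret pair_sigma_finite M lborel ..
  have "(\<integral>\<^sup>+\<omega>. ennreal (exp ((Z \<omega>)\<^sup>2 / 4)) \<partial>M)
      = (\<integral>\<^sup>+\<omega>. \<integral>\<^sup>+g. ennreal (std_normal_density g * exp (Z \<omega> / sqrt 2 * g)) \<partial>lborel \<partial>M)"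
    by (subst nn_integral_exp_normal_density) (simp_all add: power_divide)
  also have "\<dots> = (\<integral>\<^sup>+g. \<integral>\<^sup>+\<omega>. ennreal (std_normal_density g * exp (Z \<omega> / sqrt 2 * g)) \<partial>M \<partial>lborel)"
    by (rule Fubini'[symmetric]) measurable
  also have "\<dots> = (\<integral>\<^sup>+g. ennreal (std_normal_density g) * (\<integral>\<^sup>+\<omega>. ennreal (exp ((g / sqrt 2) * Z \<omega>)) \<partial>M) \<partial>lborel)"
    by (simp add: ennreal_mult nn_integral_cmult mult_ac)
  \<comment> \<open>At \<open>s = g / sqrt 2\<close> the hypothesis gives
    \<open>exp (g^2 / 4)\<close>, which cancels only half of the Gaussian exponent, so the integral
    over \<open>g\<close> stays finite.\<close>
  also have "\<dots> \<le> (\<integral>\<^sup>+g. ennreal (std_normal_density g) * ennreal (exp (1 * (g / sqrt 2)\<^sup>2 / 2)) \<partial>lborel)"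
    using assms unfolding strict_subgaussian_def
    by (intro nn_integral_mono mult_left_mono) (blast, simp)
  also have "\<dots> = ennreal (sqrt 2)"
    by (simp add: nn_integral_normal_density_exp_square power_divide flip: ennreal_mult)
  also have "\<dots> \<le> ennreal 2"
    by (rule ennreal_leI) (simp add: real_sqrt_le_iff' )
  finally show ?thesis by simp
qed

text \<open>Second-order Taylor expansion with Lagrange remainder. The linear term stays exact so
  that the variance can enter, and the remainder carries \<open>l^2\<close> for either sign of
  \<open>l\<close>.\<close>

lemma exp_mult_square_le:
  fixes z l :: real
  assumes "\<bar>l\<bar> \<le> 1 / 8"
  shows "exp (l * z\<^sup>2) \<le> 1 + l * z\<^sup>2 + 64 * l\<^sup>2 * exp (z\<^sup>2 / 4)"
proof -
  \<comment> \<open>With this \<open>y\<close> the allowance \<open>exp (z^2 / 4)\<close> splits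
    into two factors \<open>exp y\<close>. One dominates \<open>exp t\<close>, thanks to the bound
    on \<open>l\<close>; the other dominates \<open>y^2 / 2\<close>.\<close>
  define y where "y = z\<^sup>2 / 8"
  have y: "0 \<le> y" "l * z\<^sup>2 = 8 * l * y" "z\<^sup>2 / 4 = y + y"
    by (auto simp: y_def)
  obtain t where t: "\<bar>t\<bar> \<le> \<bar>8 * l * y\<bar>"
    and "exp (8 * l * y) = (\<Sum>m<2. (8 * l * y) ^ m / fact m) + exp t / fact 2 * (8 * l * y) ^ 2"
    using Maclaurin_exp_le[of "8 * l * y" 2] by blast
  then have "exp (8 * l * y) = 1 + 8 * l * y + exp t / 2 * (8 * l * y)\<^sup>2"
    by (simp add: numeral_2_eq_2)
  also have "exp t / 2 * (8 * l * y)\<^sup>2 = 64 * l\<^sup>2 * (exp t * (y\<^sup>2 / 2))"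
    by (simp add: power2_eq_square)
  also have "\<dots> \<le> 64 * l\<^sup>2 * (exp y * exp y)"
  proof (intro mult_left_mono mult_mono)
    have "\<bar>8 * l * y\<bar> = (8 * \<bar>l\<bar>) * y" using y by (simp add: abs_mult)
    also have "\<dots> \<le> 1 * y" using assms y by (intro mult_right_mono) auto
    finally show "exp t \<le> exp y" using t by simp
    show "y\<^sup>2 / 2 \<le> exp y" using exp_lower_Taylor_quadratic[OF y(1)] y(1) by simp
  qed auto
  finally show ?thesis by (simp only: y exp_add)
qed

text \<open>In expectation the linear term of the pointwise bound becomes \<open>l\<close> and the
  remainder at most \<open>64 * 2 * l^2\<close>, whence 128. The form \<open>exp\<close> of a sum is
  chosen because it multiplies well over independent variables.\<close>

lemma (in prob_space) nn_integral_exp_mult_square_le: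
  assumes Z: "strict_subgaussian 1 M Z" and l: "\<bar>l\<bar> \<le> 1 / 8"
  shows "(\<integral>\<^sup>+\<omega>. ennreal (exp (l * (Z \<omega>)\<^sup>2)) \<partial>M) \<le> ennreal (exp (l + 128 * l\<^sup>2))"
proof -
  note [measurable] = strict_subgaussian_measurable[OF Z]
  note E = nn_integral_exp_square_le[OF Z]
  let ?e = "\<lambda>\<omega>. exp ((Z \<omega>)\<^sup>2 / 4)"
  have int: "integrable M ?e"
    using E by (intro integrableI_bounded) (auto simp: order_le_less_trans)
  have "ennreal (expectation ?e) \<le> ennreal 2"
    using E nn_integral_eq_integral[OF int] by simp
  then have le2: "expectation ?e \<le> 2" by (subst (asm) ennreal_le_iff) simp_all
  have sq: "integrable M (\<lambda>\<omega>. (Z \<omega>)\<^sup>2)" "expectation (\<lambda>\<omega>. (Z \<omega>)\<^sup>2) = 1"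
    using Z by (auto simp: strict_subgaussian_def has_bochner_integral_iff)
  let ?b = "\<lambda>\<omega>. 1 + l * (Z \<omega>)\<^sup>2 + 64 * l\<^sup>2 * ?e \<omega>"
  have b: "exp (l * (Z \<omega>)\<^sup>2) \<le> ?b \<omega>" for \<omega>
    by (rule exp_mult_square_le[OF l])
  have "(\<integral>\<^sup>+\<omega>. ennreal (exp (l * (Z \<omega>)\<^sup>2)) \<partial>M) \<le> (\<integral>\<^sup>+\<omega>. ennreal (?b \<omega>) \<partial>M)"
    by (intro nn_integral_mono ennreal_leI b)
  also have "\<dots> = ennreal (expectation ?b)"
  proof (rule nn_integral_eq_integral)
    \<comment> \<open>Although \<open>l\<close> may be negative, the majorant lies above an
      exponential.\<close>
    show "AE \<omega> in M. 0 \<le> ?b \<omega>"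
      using order_trans[OF exp_ge_zero b] by simp
  qed (use int sq in simp)
  also have "expectation ?b = 1 + l + 64 * l\<^sup>2 * expectation ?e"
    using int sq by (simp add: prob_space)
  also have "\<dots> \<le> 1 + (l + 128 * l\<^sup>2)"
    using mult_left_mono[OF le2, of "64 * l\<^sup>2"] by simp
  also have "\<dots> \<le> exp (l + 128 * l\<^sup>2)"
    by (rule exp_ge_add_one_self)
  finally show ?thesis by (simp add: ennreal_leI)
qed

section \<open>Concentration of sums of squares\<close>

text \<open>The factor \<open>\<delta>\<close> lets one Chernoff argument serve both tails: dividing
  by it gives the upper tail when it is positive and the lower tail when it is negative.\<close>

lemma (in prob_space) prob_sum_mult_ge_le:
  fixes Z :: "'i \<Rightarrow> 'a \<Rightarrow> real" and \<delta> :: real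
  assumes I: "finite I" and ind: "indep_vars (\<lambda>_. borel) Z I"
    and Z: "\<And>i. i \<in> I \<Longrightarrow> strict_subgaussian 1 M (Z i)"
    and \<delta>: "\<bar>\<delta>\<bar> \<le> 1"
  shows "prob {\<omega> \<in> space M. \<delta> * (\<Sum>i\<in>I. (Z i \<omega>)\<^sup>2) \<ge> (\<delta> + \<delta>\<^sup>2) * card I} \<le> exp (- (card I * \<delta>\<^sup>2 / 512))"
proof -
  have [measurable]: "Z i \<in> borel_measurable M" if "i \<in> I" for i
    using strict_subgaussian_measurable Z that by blast
  \<comment> \<open>Chernoff's exponent is \<open>card I * (128 * l^2 - l * \<delta>)\<close>. This
    \<open>l\<close> minimizes it, with value \<open>- (card I * \<delta>^2 / 512)\<close>.\<close>
  define l where "l = \<delta> / 256"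
  have "indep_vars (\<lambda>_. borel) (\<lambda>i \<omega>. ennreal (exp (l * (Z i \<omega>)\<^sup>2))) I"
    by (rule indep_vars_compose2[OF ind, where Y = "\<lambda>i x. ennreal (exp (l * x\<^sup>2))"]) measurable
  then have "(\<integral>\<^sup>+\<omega>. (\<Prod>i\<in>I. ennreal (exp (l * (Z i \<omega>)\<^sup>2))) \<partial>M) =
      (\<Prod>i\<in>I. \<integral>\<^sup>+\<omega>. ennreal (exp (l * (Z i \<omega>)\<^sup>2)) \<partial>M)"
    by (rule indep_vars_nn_integral[OF I]) simp
  also have "\<dots> \<le> (\<Prod>i\<in>I. ennreal (exp (l + 128 * l\<^sup>2)))"
    using \<delta> by (intro prod_mono_ennreal nn_integral_exp_mult_square_le Z) (auto simp: l_def)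
  also have "\<dots> = ennreal (exp (card I * (l + 128 * l\<^sup>2)))"
    by (simp add: prod_ennreal exp_of_nat_mult ennreal_power)
  finally have mgf: "(\<integral>\<^sup>+\<omega>. ennreal (exp (l * (\<Sum>i\<in>I. (Z i \<omega>)\<^sup>2))) \<partial>M)
      \<le> ennreal (exp (card I * (l + 128 * l\<^sup>2)))"
    by (simp add: prod_ennreal exp_sum[OF I, symmetric] sum_distrib_left)
  \<comment> \<open>Since the variable is already multiplied by \<open>\<delta>\<close>, the
    positive parameter 1/256 reproduces \<open>l\<close> with either sign.\<close>
  have "emeasure M {\<omega> \<in> space M. \<delta> * (\<Sum>i\<in>I. (Z i \<omega>)\<^sup>2) \<ge> (\<delta> + \<delta>\<^sup>2) * card I}
      \<le> ennreal (exp (- (1 / 256) * ((\<delta> + \<delta>\<^sup>2) * card I))) *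
        (\<integral>\<^sup>+\<omega>. ennreal (exp (1 / 256 * (\<delta> * (\<Sum>i\<in>I. (Z i \<omega>)\<^sup>2)))) * indicator (space M) \<omega> \<partial>M)"
    by (rule Chernoff_ineq_nn_integral_ge) auto
  also have "(\<integral>\<^sup>+\<omega>. ennreal (exp (1 / 256 * (\<delta> * (\<Sum>i\<in>I. (Z i \<omega>)\<^sup>2)))) * indicator (space M) \<omega> \<partial>M)
      = (\<integral>\<^sup>+\<omega>. ennreal (exp (l * (\<Sum>i\<in>I. (Z i \<omega>)\<^sup>2))) \<partial>M)"
    by (rule nn_integral_cong) (simp add: l_def)
  also have "ennreal (exp (- (1 / 256) * ((\<delta> + \<delta>\<^sup>2) * card I))) * \<dots>
      \<le> ennreal (exp (- (1 / 256) * ((\<delta> + \<delta>\<^sup>2) * card I))) * ennreal (exp (card I * (l + 128 * l\<^sup>2)))"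
    by (intro mult_left_mono mgf) simp
  also have "\<dots> = ennreal (exp (- (1 / 256) * ((\<delta> + \<delta>\<^sup>2) * card I) + card I * (l + 128 * l\<^sup>2)))"
    by (simp only: exp_add ennreal_mult exp_ge_zero)
  also have "- (1 / 256) * ((\<delta> + \<delta>\<^sup>2) * card I) + card I * (l + 128 * l\<^sup>2) = - (card I * \<delta>\<^sup>2 / 512)"
    by (simp add: l_def field_simps power2_eq_square)
  finally show ?thesis
    by (simp add: emeasure_eq_measure)
qed

lemma (in prob_space) prob_sum_squares_deviation_le:
  fixes Z :: "'i \<Rightarrow> 'a \<Rightarrow> real" and \<epsilon> :: real
  assumes I: "finite I" and ind: "indep_vars (\<lambda>_. borel) Z I"
    and Z: "\<And>i. i \<in> I \<Longrightarrow> strict_subgaussian 1 M (Z i)"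
    and \<epsilon>: "0 < \<epsilon>" "\<epsilon> \<le> 1"
  shows "prob {\<omega> \<in> space M. \<bar>(\<Sum>i\<in>I. (Z i \<omega>)\<^sup>2) - card I\<bar> \<ge> \<epsilon> * card I} \<le> 2 * exp (- (card I * \<epsilon>\<^sup>2 / 512))"
proof -
  have [measurable]: "Z i \<in> borel_measurable M" if "i \<in> I" for i
    using strict_subgaussian_measurable Z that by blast
  let ?A = "\<lambda>\<delta>. {\<omega> \<in> space M. \<delta> * (\<Sum>i\<in>I. (Z i \<omega>)\<^sup>2) \<ge> (\<delta> + \<delta>\<^sup>2) * card I}"
  have "{\<omega> \<in> space M. \<bar>(\<Sum>i\<in>I. (Z i \<omega>)\<^sup>2) - card I\<bar> \<ge> \<epsilon> * card I} \<subseteq> ?A \<epsilon> \<union> ?A (- \<epsilon>)"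
  proof safe
    fix \<omega> assume w: "\<epsilon> * card I \<le> \<bar>(\<Sum>i\<in>I. (Z i \<omega>)\<^sup>2) - card I\<bar>"
      "\<not> (- \<epsilon> + (- \<epsilon>)\<^sup>2) * card I \<le> - \<epsilon> * (\<Sum>i\<in>I. (Z i \<omega>)\<^sup>2)"
    let ?S = "\<Sum>i\<in>I. (Z i \<omega>)\<^sup>2"
    \<comment> \<open>Failure of the lower-tail event rules out the negative side of the absolute
      value, so only the upper tail remains.\<close>
    have "\<epsilon> * ((1 - \<epsilon>) * card I) < \<epsilon> * ?S"
      using w(2) by (simp add: algebra_simps power2_eq_square)
    then have "(1 - \<epsilon>) * card I < ?S" using \<epsilon> by simp
    then have "(1 + \<epsilon>) * card I \<le> ?S" using w(1) by (simp add: algebra_simps abs_if split: if_splits)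
    then have "\<epsilon> * ((1 + \<epsilon>) * card I) \<le> \<epsilon> * ?S" using \<epsilon> by simp
    then show "(\<epsilon> + \<epsilon>\<^sup>2) * card I \<le> \<epsilon> * ?S" by (simp add: algebra_simps power2_eq_square)
  qed
  then have "prob {\<omega> \<in> space M. \<bar>(\<Sum>i\<in>I. (Z i \<omega>)\<^sup>2) - card I\<bar> \<ge> \<epsilon> * card I} \<le> prob (?A \<epsilon> \<union> ?A (- \<epsilon>))"
    by (intro finite_measure_mono) auto
  also have "\<dots> \<le> prob (?A \<epsilon>) + prob (?A (- \<epsilon>))"
    by (intro measure_Un_le) auto
  also have "\<dots> \<le> 2 * exp (- (card I * \<epsilon>\<^sup>2 / 512))"
    using prob_sum_mult_ge_le[OF I ind Z, of \<epsilon>] prob_sum_mult_ge_le[OF I ind Z, of "- \<epsilon>"] \<epsilon> by simp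
  finally show ?thesis .
qed

subsection \<open>Random matrices with independent entries\<close>

text \<open>Passes between a law and a random variable having that law; used for random signs and
  for single matrix entries.\<close>

lemma strict_subgaussian_distr:
  assumes [measurable]: "f \<in> measurable M N" "X \<in> borel_measurable N"
  shows "strict_subgaussian v (distr M N f) X \<longleftrightarrow> strict_subgaussian v M (\<lambda>\<omega>. X (f \<omega>))"
  unfolding strict_subgaussian_def has_bochner_integral_iff
  by (simp add: nn_integral_distr integrable_distr_eq integral_distr)

section \<open>Gaussian and Bernoulli entry laws\<close>

lemma strict_subgaussian_gaussian_entry:
  assumes "0 < r"
  shows "strict_subgaussian (1 / real r) (gaussian_entry r) (\<lambda>x. x)"
proof -
  define \<sigma> where "\<sigma> = 1 / sqrt (real r)"
  have \<sigma>: "0 < \<sigma>" "\<sigma>\<^sup>2 = 1 / real r"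
    using assms by (auto simp: \<sigma>_def power_divide)
  have "(\<integral>\<^sup>+x. ennreal (exp (s * x)) \<partial>density lborel (normal_density 0 \<sigma>)) = ennreal (exp (\<sigma>\<^sup>2 * s\<^sup>2 / 2))" for s
    using nn_integral_exp_normal_density[OF \<sigma>(1), of s]
    by (simp add: nn_integral_density ennreal_mult)
  moreover have "has_bochner_integral (density lborel (normal_density 0 \<sigma>)) (\<lambda>x. x) 0"
    using normal_moment_nz_1[OF \<sigma>(1), of 0] by (intro has_bochner_integral_density) auto
  moreover have "has_bochner_integral (density lborel (normal_density 0 \<sigma>)) (\<lambda>x. x\<^sup>2) (\<sigma>\<^sup>2)"
    using normal_moment_even[OF \<sigma>(1), of 0 1] by (intro has_bochner_integral_density) auto
  ultimately show ?thesis
    unfolding strict_subgaussian_def gaussian_entry_def \<sigma>_def[symmetric] \<sigma>(2)[symmetric] by simp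
qed

text \<open>Hoeffding's lemma on an interval of length \<open>2 * a\<close> gives the proxy
  \<open>(2 * a)^2 / 4 = a^2\<close>, which is exactly the variance of the sign
  \<open>\<plusminus>a\<close>.\<close>

lemma strict_subgaussian_bernoulli_entry:
  assumes "0 < r"
  shows "strict_subgaussian (1 / real r) (bernoulli_entry r) (\<lambda>x. x)"
proof -
  define a where "a = 1 / sqrt (real r)"
  have a: "0 < a" "a\<^sup>2 = 1 / real r"
    using assms by (auto simp: a_def power_divide)
  let ?M = "measure_pmf (bernoulli_pmf (1 / 2))"
  define R where "R = (\<lambda>b. if b then a else - a)"
  interpret interval_bounded_random_variable ?M R "- a" a
    using a by unfold_locales (auto simp: R_def)
  have mean: "integral\<^sup>L ?M R = 0" by (simp add: R_def)
  have mgf: "(\<integral>\<^sup>+b. ennreal (exp (s * R b)) \<partial>?M) \<le> ennreal (exp (a\<^sup>2 * s\<^sup>2 / 2))" for s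
  proof (cases "s = 0")
    case False
    \<comment> \<open>Hoeffding's lemma wants a positive parameter; the symmetry of \<open>R\<close>
      allows replacing \<open>s\<close> by its absolute value.\<close>
    have "(\<integral>\<^sup>+b. ennreal (exp (s * R b)) \<partial>?M) = (\<integral>\<^sup>+b. ennreal (exp (\<bar>s\<bar> * R b)) \<partial>?M)"
      by (cases "s < 0") (simp_all add: R_def add.commute)
    also have "\<dots> \<le> ennreal (exp (\<bar>s\<bar>\<^sup>2 * (a - - a)\<^sup>2 / 8))"
      using False by (intro Hoeffdings_lemma_nn_integral_0 mean) simp
    finally show ?thesis by (simp add: power_mult_distrib mult_ac)
  qed simp
  have "strict_subgaussian (a\<^sup>2) ?M R"
    unfolding strict_subgaussian_def has_bochner_integral_iff
    using mgf mean by (auto simp: R_def integrable_measure_pmf_finite)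
  moreover have "R = (\<lambda>b. (if b then 1 else - 1) / sqrt (real r))"
    by (auto simp: R_def a_def)
  ultimately show ?thesis
    by (simp add: bernoulli_entry_def strict_subgaussian_distr a)
qed

lemma prob_space_gaussian_entry: "0 < r \<Longrightarrow> prob_space (gaussian_entry r)"
  by (simp add: gaussian_entry_def prob_space_normal_density)

lemma prob_space_bernoulli_entry: "prob_space (bernoulli_entry r)"
  unfolding bernoulli_entry_def by (rule measure_pmf.prob_space_distr) simp

lemma sets_gaussian_entry: "sets (gaussian_entry r) = sets borel"
  by (simp add: gaussian_entry_def)

lemma sets_bernoulli_entry: "sets (bernoulli_entry r) = sets borel"
  by (simp add: bernoulli_entry_def)

section \<open>Product law of the matrix entries\<close>

lemma prob_space_iid_entries: "prob_space \<nu> \<Longrightarrow> prob_space (iid_entries r N \<nu>)"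
  unfolding iid_entries_def by (rule prob_space_PiM)

lemma measurable_iid_entries_component:
  assumes "sets \<nu> = sets borel" "i < r" "j < N"
  shows "(\<lambda>\<omega>. \<omega> (i, j)) \<in> borel_measurable (iid_entries r N \<nu>)"
proof -
  have "(\<lambda>\<omega>. \<omega> (i, j)) \<in> measurable (iid_entries r N \<nu>) \<nu>"
    unfolding iid_entries_def using assms by (intro measurable_component_singleton) auto
  then show ?thesis
    using measurable_cong_sets[OF refl assms(1)] by blast
qed

text \<open>Independence amounts to the joint law being the product of the marginals, and here the
  joint law is the product measure itself. That criterion requires a nonempty index set, hence the
  case split.\<close>

lemma indep_vars_iid_entries:
  assumes \<nu>: "prob_space \<nu>"
  shows "prob_space.indep_vars (iid_entries r N \<nu>) (\<lambda>_. \<nu>) (\<lambda>k \<omega>. \<omega> k) ({..<r} \<times> {..<N})"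
proof -
  let ?I = "{..<r} \<times> {..<N}"
  interpret prob_space "iid_entries r N \<nu>"
    by (rule prob_space_iid_entries[OF \<nu>])
  show ?thesis
  proof (cases "?I = {}")
    case True
    show ?thesis unfolding indep_vars_def indep_sets_def True by auto
  next
    case False
    have comp: "(\<lambda>\<omega>. \<omega> k) \<in> measurable (iid_entries r N \<nu>) \<nu>" if "k \<in> ?I" for k
      unfolding iid_entries_def by (rule measurable_component_singleton[OF that])
    have "distr (iid_entries r N \<nu>) (Pi\<^sub>M ?I (\<lambda>_. \<nu>)) (\<lambda>\<omega>. \<lambda>k\<in>?I. \<omega> k)
        = distr (Pi\<^sub>M ?I (\<lambda>_. \<nu>)) (Pi\<^sub>M ?I (\<lambda>_. \<nu>)) (\<lambda>\<omega>. \<omega>)"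
      unfolding iid_entries_def
      by (intro distr_cong refl) (auto simp: space_PiM PiE_restrict)
    also have "\<dots> = Pi\<^sub>M ?I (\<lambda>k. distr (iid_entries r N \<nu>) \<nu> (\<lambda>\<omega>. \<omega> k))"
      unfolding iid_entries_def distr_id by (intro PiM_cong refl distr_PiM_component[symmetric] \<nu>)
    finally show ?thesis
      using indep_vars_iff_distr_eq_PiM'[OF False, where M' = "\<lambda>_. \<nu>" and X = "\<lambda>k \<omega>. \<omega> k", OF comp]
      by simp
  qed
qed

lemma strict_subgaussian_iid_entries_component:
  assumes \<nu>: "prob_space \<nu>" "sets \<nu> = sets borel" "strict_subgaussian v \<nu> (\<lambda>x. x)"
    and k: "k \<in> {..<r} \<times> {..<N}"
  shows "strict_subgaussian v (iid_entries r N \<nu>) (\<lambda>\<omega>. \<omega> k)"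
proof -
  have "(\<lambda>\<omega>. \<omega> k) \<in> measurable (iid_entries r N \<nu>) \<nu>"
    unfolding iid_entries_def by (rule measurable_component_singleton[OF k])
  moreover have "distr (iid_entries r N \<nu>) \<nu> (\<lambda>\<omega>. \<omega> k) = \<nu>"
    unfolding iid_entries_def by (rule distr_PiM_component[OF \<nu>(1) k])
  ultimately show ?thesis
    using strict_subgaussian_distr[of _ "iid_entries r N \<nu>" \<nu> "\<lambda>x. x" v]
      strict_subgaussian_measurable[OF \<nu>(3)] \<nu>(3) by metis
qed

text \<open>Different rows read disjoint blocks of entries, which gives independence across rows.
  Within one row the sum rule for independent strictly sub-Gaussian variables applies.\<close>

lemma
  assumes \<nu>: "prob_space \<nu>" "sets \<nu> = sets borel" "strict_subgaussian v \<nu> (\<lambda>x. x)"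
  shows indep_vars_iid_rows: "prob_space.indep_vars (iid_entries r N \<nu>) (\<lambda>_. borel)
      (\<lambda>i \<omega>. \<Sum>j<N. u j * \<omega> (i, j)) {..<r}" (is ?indep)
    and strict_subgaussian_iid_row: "i < r \<Longrightarrow>
      strict_subgaussian (v * (\<Sum>j<N. (u j)\<^sup>2)) (iid_entries r N \<nu>) (\<lambda>\<omega>. \<Sum>j<N. u j * \<omega> (i, j))"
proof -
  let ?row = "\<lambda>i. {i} \<times> {..<N}"
  interpret prob_space "iid_entries r N \<nu>"
    by (rule prob_space_iid_entries[OF \<nu>(1)])
  note ind = indep_vars_iid_entries[OF \<nu>(1), of r N]
  have row_sum: "(\<Sum>k\<in>?row i. f k) = (\<Sum>j<N. f (i, j))" for i and f :: "nat \<times> nat \<Rightarrow> real"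
    by (rule sum.reindex_bij_witness[of _ "\<lambda>j. (i, j)" snd]) auto
  have "indep_vars (\<lambda>i. Pi\<^sub>M (?row i) (\<lambda>_. \<nu>)) (\<lambda>i \<omega>. restrict (\<lambda>k. \<omega> k) (?row i)) {..<r}"
    by (rule indep_vars_restrict[OF ind]) (auto simp: disjoint_family_on_def)
  then have "indep_vars (\<lambda>_. borel)
      (\<lambda>i \<omega>. (\<lambda>f. \<Sum>k\<in>?row i. u (snd k) * f k) (restrict (\<lambda>k. \<omega> k) (?row i))) {..<r}"
  proof (rule indep_vars_compose2)
    fix i
    have "(\<lambda>f. f k) \<in> borel_measurable (Pi\<^sub>M (?row i) (\<lambda>_. \<nu>))" if "k \<in> ?row i" for k
      using measurable_component_singleton[OF that, of "\<lambda>_. \<nu>"] measurable_cong_sets[OF refl \<nu>(2)] by blast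
    then show "(\<lambda>f. \<Sum>k\<in>?row i. u (snd k) * f k) \<in> borel_measurable (Pi\<^sub>M (?row i) (\<lambda>_. \<nu>))"
      by (intro borel_measurable_sum borel_measurable_times borel_measurable_const)
  qed
  then show ?indep by (simp add: row_sum)
  assume i: "i < r"
  \<comment> \<open>Composing with the identity from \<open>\<nu>\<close> to \<open>borel\<close>
    moves independence to the target space that the sum rule expects.\<close>
  have "indep_vars (\<lambda>_. borel) (\<lambda>k \<omega>. \<omega> k) ({..<r} \<times> {..<N})"
    using indep_vars_compose2[OF ind, of "\<lambda>_ x. x" "\<lambda>_. borel"] strict_subgaussian_measurable[OF \<nu>(3)]
    by simp
  then have "indep_vars (\<lambda>_. borel) (\<lambda>k \<omega>. \<omega> k) (?row i)"
    by (rule indep_vars_subset) (use i in auto)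
  then have "strict_subgaussian (v * (\<Sum>k\<in>?row i. (u (snd k))\<^sup>2)) (iid_entries r N \<nu>)
      (\<lambda>\<omega>. \<Sum>k\<in>?row i. u (snd k) * \<omega> k)"
    using i by (intro strict_subgaussian_sum strict_subgaussian_iid_entries_component \<nu>) auto
  then show "strict_subgaussian (v * (\<Sum>j<N. (u j)\<^sup>2)) (iid_entries r N \<nu>) (\<lambda>\<omega>. \<Sum>j<N. u j * \<omega> (i, j))"
    by (simp add: row_sum)
qed

subsection \<open>Near isometry and the cross validation bounds\<close>

lemma l2norm_nonneg: "0 \<le> l2norm v"
  by (simp add: l2norm_def)

lemma l2norm_pos:
  assumes "v \<in> carrier_vec N" "v \<noteq> 0\<^sub>v N"
  shows "0 < l2norm v"
proof -
  have "l2norm v \<noteq> 0"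
    using assms by (auto simp: l2norm_def L2_set_eq_0_iff)
  then show ?thesis
    using l2norm_nonneg[of v] by simp
qed

lemma l2norm_mat_mult_vec:
  "v \<in> carrier_vec N \<Longrightarrow> l2norm (mat r N \<omega> *\<^sub>v v) = sqrt (\<Sum>i<r. (\<Sum>j<N. \<omega> (i, j) * v $ j)\<^sup>2)"
  by (auto simp: l2norm_def L2_set_def scalar_prod_def atLeast0LessThan intro!: sum.cong)

lemma l2norm_square: "v \<in> carrier_vec N \<Longrightarrow> (l2norm v)\<^sup>2 = (\<Sum>j<N. (v $ j)\<^sup>2)"
  by (simp add: l2norm_def L2_set_def sum_nonneg)

text \<open>Products instead of quotients keep this meaningful at the zero vector, so
  \<open>x = 0\<close> and exact estimates need no exception in the union bound.\<close>

definition nearly_isometric_at :: "real \<Rightarrow> real mat \<Rightarrow> real vec \<Rightarrow> bool" where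
  "nearly_isometric_at \<epsilon> A v \<longleftrightarrow>
     (1 - \<epsilon>) * l2norm v \<le> l2norm (A *\<^sub>v v) \<and> l2norm (A *\<^sub>v v) \<le> (1 + \<epsilon>) * l2norm v"

text \<open>Since \<open>(1 - \<epsilon>)^2 \<le> 1 - \<epsilon>\<close> and
  \<open>1 + \<epsilon> \<le> (1 + \<epsilon>)^2\<close>, a relative deviation
  \<open>\<epsilon>\<close> of the squares already controls the norms.\<close>

lemma nearly_isometric_atI:
  assumes \<epsilon>: "0 \<le> \<epsilon>" "\<epsilon> \<le> 1"
    and dev: "\<bar>(l2norm (A *\<^sub>v v))\<^sup>2 - (l2norm v)\<^sup>2\<bar> \<le> \<epsilon> * (l2norm v)\<^sup>2"
  shows "nearly_isometric_at \<epsilon> A v"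
  unfolding nearly_isometric_at_def
proof
  have sq: "\<epsilon>\<^sup>2 \<le> \<epsilon>" using \<epsilon> by (simp add: power2_eq_square mult_left_le)
  have "((1 - \<epsilon>) * l2norm v)\<^sup>2 \<le> (1 - \<epsilon>) * (l2norm v)\<^sup>2"
    unfolding power_mult_distrib using sq by (intro mult_right_mono) (auto simp: power2_diff)
  also have "\<dots> \<le> (l2norm (A *\<^sub>v v))\<^sup>2" using dev by (simp add: algebra_simps)
  finally show "(1 - \<epsilon>) * l2norm v \<le> l2norm (A *\<^sub>v v)"
    by (rule power2_le_imp_le) (rule l2norm_nonneg)
  have "(l2norm (A *\<^sub>v v))\<^sup>2 \<le> (1 + \<epsilon>) * (l2norm v)\<^sup>2" using dev by (simp add: algebra_simps)
  also have "\<dots> \<le> ((1 + \<epsilon>) * l2norm v)\<^sup>2"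
    unfolding power_mult_distrib using \<epsilon> by (intro mult_right_mono) (auto simp: power2_sum)
  finally show "l2norm (A *\<^sub>v v) \<le> (1 + \<epsilon>) * l2norm v"
    by (rule power2_le_imp_le) (use \<epsilon> in \<open>simp add: l2norm_nonneg\<close>)
qed

lemma ratio_betweenI:
  assumes "0 < \<epsilon>" "\<epsilon> < 1" "0 < a" "(1 - \<epsilon>) * a \<le> b" "b \<le> (1 + \<epsilon>) * a"
  shows "ratio_between (1 / (1 + \<epsilon>)) a b (1 / (1 - \<epsilon>))"
proof -
  have "0 < (1 - \<epsilon>) * a" using assms by simp
  then have "0 < b" using assms by linarith
  then show ?thesis
    using assms unfolding ratio_between_def by (simp add: field_simps)
qed

text \<open>The double quotient is \<open>(a / b) * (d / c)\<close>, which lies between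
  \<open>(1 - \<epsilon>) / (1 + \<epsilon>)\<close> and
  \<open>(1 + \<epsilon>) / (1 - \<epsilon>)\<close>. The claimed bounds are weaker.\<close>

lemma ratio_between_quotientI:
  assumes \<epsilon>: "0 < \<epsilon>" "\<epsilon> < 1"
    and a: "0 < a" "(1 - \<epsilon>) * a \<le> b" "b \<le> (1 + \<epsilon>) * a"
    and c: "0 < c" "(1 - \<epsilon>) * c \<le> d" "d \<le> (1 + \<epsilon>) * c"
  shows "ratio_between ((1 - 3 * \<epsilon>) / ((1 + \<epsilon>) * (1 - \<epsilon>)\<^sup>2)) (a / c) (b / d) (1 / (1 - \<epsilon>)\<^sup>2)"
proof -
  have ab: "b \<noteq> 0" "1 / (1 + \<epsilon>) \<le> a / b" "a / b \<le> 1 / (1 - \<epsilon>)"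
    using ratio_betweenI[OF \<epsilon> a] by (auto simp: ratio_between_def)
  have "0 < (1 - \<epsilon>) * c" using \<epsilon> c by simp
  then have d: "0 < d" using c by linarith
  have dc: "1 - \<epsilon> \<le> d / c" "d / c \<le> 1 + \<epsilon>"
    using c by (auto simp: field_simps)
  have eq: "(a / c) / (b / d) = (a / b) * (d / c)" by simp
  \<comment> \<open>Bernoulli's inequality for the cube; after cancelling the square, the left end
    is at most \<open>(1 - \<epsilon>) / (1 + \<epsilon>)\<close>.\<close>
  have cube: "1 - 3 * \<epsilon> \<le> (1 - \<epsilon>) * (1 - \<epsilon>)\<^sup>2"
  proof -
    have "(1 - \<epsilon>) * (1 - \<epsilon>)\<^sup>2 = 1 - 3 * \<epsilon> + \<epsilon>\<^sup>2 * (3 - \<epsilon>)"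
      by (simp add: algebra_simps power2_eq_square)
    then show ?thesis using \<epsilon> by simp
  qed
  have "(1 - 3 * \<epsilon>) / ((1 + \<epsilon>) * (1 - \<epsilon>)\<^sup>2) \<le> (1 - \<epsilon>) * (1 - \<epsilon>)\<^sup>2 / ((1 + \<epsilon>) * (1 - \<epsilon>)\<^sup>2)"
    using cube \<epsilon> by (intro divide_right_mono) auto
  also have "\<dots> = 1 / (1 + \<epsilon>) * (1 - \<epsilon>)" using \<epsilon> by simp
  also have "\<dots> \<le> a / b * (d / c)"
    using ab dc \<epsilon> order_trans[OF _ ab(2), of 0] by (intro mult_mono) auto
  finally have lo: "(1 - 3 * \<epsilon>) / ((1 + \<epsilon>) * (1 - \<epsilon>)\<^sup>2) \<le> a / b * (d / c)" .
  have "a / b * (d / c) \<le> 1 / (1 - \<epsilon>) * (1 + \<epsilon>)"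
    using ab dc \<epsilon> c d by (intro mult_mono) auto
  also have "\<dots> \<le> 1 / (1 - \<epsilon>) * (1 / (1 - \<epsilon>))"
    using \<epsilon> by (intro mult_left_mono) (auto simp: field_simps)
  finally have hi: "a / b * (d / c) \<le> 1 / (1 - \<epsilon>)\<^sup>2"
    by (simp add: power2_eq_square)
  show ?thesis
    unfolding ratio_between_def eq using lo hi ab(1) d by simp
qed

text \<open>The two minima may sit at different indices; testing at a minimizer of \<open>a\<close>
  suffices.\<close>

lemma Min_image_le_mult:
  fixes a b :: "'i \<Rightarrow> real"
  assumes I: "finite I" "I \<noteq> {}" and "0 \<le> c" "\<And>i. i \<in> I \<Longrightarrow> b i \<le> c * a i"
  shows "Min (b ` I) \<le> c * Min (a ` I)"
proof -
  have "Min (a ` I) \<in> a ` I" using I by (intro Min_in) auto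
  then obtain i where i: "i \<in> I" "Min (a ` I) = a i" by auto
  have "Min (b ` I) \<le> b i" using I i by simp
  with assms(4)[OF i(1)] i show ?thesis by simp
qed

text \<open>Dually, the test index is a minimizer of \<open>b\<close>.\<close>

lemma mult_Min_image_le:
  fixes a b :: "'i \<Rightarrow> real"
  assumes I: "finite I" "I \<noteq> {}" and "0 \<le> c" "\<And>i. i \<in> I \<Longrightarrow> c * a i \<le> b i"
  shows "c * Min (a ` I) \<le> Min (b ` I)"
proof -
  have "Min (b ` I) \<in> b ` I" using I by (intro Min_in) auto
  then obtain i where i: "i \<in> I" "Min (b ` I) = b i" by auto
  have "c * Min (a ` I) \<le> c * a i" using I i assms(3) by (intro mult_left_mono) simp_all
  with assms(4)[OF i(1)] i show ?thesis by simp
qed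

text \<open>The deterministic half of the argument: a two-sided multiplicative comparison passes to
  minima and quotients, and positivity of the norms keeps every denominator nonzero.\<close>

lemma cv_bounds_if_nearly_isometric:
  assumes \<epsilon>: "0 < \<epsilon>" "\<epsilon> < 1" and p: "1 \<le> p"
    and x: "x \<in> carrier_vec N" and xhat: "\<forall>j\<in>{1..p}. xhat j \<in> carrier_vec N"
    and iso_x: "nearly_isometric_at \<epsilon> A x"
    and iso: "\<And>j. j \<in> {1..p} \<Longrightarrow> nearly_isometric_at \<epsilon> A (x - xhat j)"
  shows "cv_bounds \<epsilon> A p x xhat"
proof -
  have pos: "0 < l2norm (x - xhat j)" if j: "j \<in> {1..p}" "x \<noteq> xhat j" for j
  proof (rule l2norm_pos)
    have xj: "xhat j \<in> carrier_vec N" using xhat j by blast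
    then show "x - xhat j \<in> carrier_vec N" using x by simp
    show "x - xhat j \<noteq> 0\<^sub>v N"
    proof
      assume "x - xhat j = 0\<^sub>v N"
      then have "x $ i = xhat j $ i" if "i < N" for i
        using that x xj index_minus_vec(1)[of i "xhat j" x] by simp
      then have "x = xhat j" using x xj by (intro eq_vecI) auto
      with j show False by simp
    qed
  qed
  note iso' = iso[unfolded nearly_isometric_at_def]
  have "ratio_between (1 / (1 + \<epsilon>)) (eta_or p x xhat) (eta_cv A p x xhat) (1 / (1 - \<epsilon>))"
    if "\<forall>j\<in>{1..p}. x \<noteq> xhat j"
  proof (rule ratio_betweenI[OF \<epsilon>])
    show "0 < eta_or p x xhat"
      unfolding eta_or_def using p pos that by (subst Min_gr_iff) auto
    show "(1 - \<epsilon>) * eta_or p x xhat \<le> eta_cv A p x xhat"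
      unfolding eta_or_def eta_cv_def using p \<epsilon> iso' by (intro mult_Min_image_le) auto
    show "eta_cv A p x xhat \<le> (1 + \<epsilon>) * eta_or p x xhat"
      unfolding eta_or_def eta_cv_def using p \<epsilon> iso' by (intro Min_image_le_mult) auto
  qed
  moreover have "0 < l2norm x" if "x \<noteq> 0\<^sub>v (dim_vec x)"
    using l2norm_pos that x by auto
  ultimately show ?thesis
    unfolding cv_bounds_def
    using pos iso' iso_x[unfolded nearly_isometric_at_def]
    by (auto intro!: ratio_betweenI[OF \<epsilon>] ratio_between_quotientI[OF \<epsilon>])
qed

section \<open>Failure probabilities and the union bound\<close>

text \<open>Row products scaled to unit variance turn the squared norm ratio into an average of
  \<open>r\<close> independent squares, to which the deviation bound applies. The zero vector cannot
  be scaled, but it is always preserved.\<close>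

lemma prob_not_nearly_isometric_le:
  assumes \<nu>: "prob_space \<nu>" "sets \<nu> = sets borel" "strict_subgaussian (1 / real r) \<nu> (\<lambda>x. x)"
    and r: "0 < r" and \<epsilon>: "0 < \<epsilon>" "\<epsilon> \<le> 1" and v: "v \<in> carrier_vec N"
  shows "\<P>(\<omega> in iid_entries r N \<nu>. \<not> nearly_isometric_at \<epsilon> (mat r N \<omega>) v) \<le> 2 * exp (- (real r * \<epsilon>\<^sup>2 / 512))"
proof (cases "v = 0\<^sub>v N")
  case True
  have "nearly_isometric_at \<epsilon> (mat r N \<omega>) v" for \<omega>
    using True by (simp add: nearly_isometric_at_def l2norm_mat_mult_vec[OF v])
      (simp add: l2norm_def L2_set_def)
  then show ?thesis by simp
next
  case False
  interpret prob_space "iid_entries r N \<nu>"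
    by (rule prob_space_iid_entries[OF \<nu>(1)])
  have pos: "0 < l2norm v" using l2norm_pos[OF v False] .
  \<comment> \<open>The factor \<open>sqrt r\<close> cancels the entry variance
    \<open>1 / r\<close>, and division by the norm makes the row product have variance one.\<close>
  define u where "u j = sqrt r * v $ j / l2norm v" for j
  define Z where "Z i \<omega> = (\<Sum>j<N. u j * \<omega> (i, j))" for i and \<omega> :: "nat \<times> nat \<Rightarrow> real"
  have "1 / real r * (\<Sum>j<N. (u j)\<^sup>2) = (\<Sum>j<N. (v $ j)\<^sup>2) / (l2norm v)\<^sup>2"
    using r by (simp add: u_def power_divide power_mult_distrib sum_distrib_left sum_divide_distrib)
  then have var: "1 / real r * (\<Sum>j<N. (u j)\<^sup>2) = 1"
    using pos by (simp flip: l2norm_square[OF v])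
  have Z: "strict_subgaussian 1 (iid_entries r N \<nu>) (Z i)" if "i \<in> {..<r}" for i
    using strict_subgaussian_iid_row[OF \<nu>, where i = i and r = r and N = N and u = u] that unfolding var Z_def by simp
  have ind: "indep_vars (\<lambda>_. borel) Z {..<r}"
    using indep_vars_iid_rows[OF \<nu>, where r = r and N = N and u = u] unfolding Z_def by simp
  have [measurable]: "Z i \<in> borel_measurable (iid_entries r N \<nu>)" if "i \<in> {..<r}" for i
    using Z[OF that] by (rule strict_subgaussian_measurable)
  have sum_Z: "(\<Sum>i<r. (Z i \<omega>)\<^sup>2) = r / (l2norm v)\<^sup>2 * (l2norm (mat r N \<omega> *\<^sub>v v))\<^sup>2" for \<omega>
  proof -
    have "Z i \<omega> = sqrt r / l2norm v * (\<Sum>j<N. \<omega> (i, j) * v $ j)" for i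
      by (simp add: Z_def u_def sum_distrib_left mult_ac)
    then have "(Z i \<omega>)\<^sup>2 = r / (l2norm v)\<^sup>2 * (\<Sum>j<N. \<omega> (i, j) * v $ j)\<^sup>2" for i
      by (simp only: power_mult_distrib power_divide) simp
    then show ?thesis
      by (simp add: l2norm_mat_mult_vec[OF v] sum_nonneg sum_distrib_left)
  qed
  have "nearly_isometric_at \<epsilon> (mat r N \<omega>) v" if "\<bar>(\<Sum>i<r. (Z i \<omega>)\<^sup>2) - r\<bar> < \<epsilon> * r" for \<omega>
  proof (rule nearly_isometric_atI)
    let ?q = "(l2norm (mat r N \<omega> *\<^sub>v v))\<^sup>2 / (l2norm v)\<^sup>2"
    have "(\<Sum>i<r. (Z i \<omega>)\<^sup>2) - r = r * (?q - 1)"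
      by (simp add: sum_Z algebra_simps)
    then have "r * \<bar>?q - 1\<bar> < r * \<epsilon>"
      using that by (simp add: abs_mult mult.commute)
    then have "\<bar>?q - 1\<bar> * (l2norm v)\<^sup>2 \<le> \<epsilon> * (l2norm v)\<^sup>2"
      using r by (intro mult_right_mono) auto
    moreover have "\<bar>?q - 1\<bar> * (l2norm v)\<^sup>2 = \<bar>(?q - 1) * (l2norm v)\<^sup>2\<bar>"
      by (simp add: abs_mult)
    moreover have "(?q - 1) * (l2norm v)\<^sup>2 = (l2norm (mat r N \<omega> *\<^sub>v v))\<^sup>2 - (l2norm v)\<^sup>2"
      using pos by (simp add: left_diff_distrib)
    ultimately show "\<bar>(l2norm (mat r N \<omega> *\<^sub>v v))\<^sup>2 - (l2norm v)\<^sup>2\<bar> \<le> \<epsilon> * (l2norm v)\<^sup>2"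
      by simp
  qed (use \<epsilon> in auto)
  then have "prob {\<omega> \<in> space (iid_entries r N \<nu>). \<not> nearly_isometric_at \<epsilon> (mat r N \<omega>) v}
      \<le> prob {\<omega> \<in> space (iid_entries r N \<nu>). \<bar>(\<Sum>i\<in>{..<r}. (Z i \<omega>)\<^sup>2) - card {..<r}\<bar> \<ge> \<epsilon> * card {..<r}}"
    by (intro finite_measure_mono) (auto simp: not_le[symmetric])
  also have "\<dots> \<le> 2 * exp (- (card {..<r} * \<epsilon>\<^sup>2 / 512))"
    by (rule prob_sum_squares_deviation_le[OF _ ind Z \<epsilon>]) auto
  finally show ?thesis by simp
qed

lemma measurable_l2norm_mat_mult_vec:
  assumes \<nu>: "sets \<nu> = sets borel" and v: "v \<in> carrier_vec N"
  shows "(\<lambda>\<omega>. l2norm (mat r N \<omega> *\<^sub>v v)) \<in> borel_measurable (iid_entries r N \<nu>)"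
  unfolding l2norm_mat_mult_vec[OF v]
  by (intro measurable_compose[OF _ borel_measurable_sqrt] borel_measurable_sum borel_measurable_power borel_measurable_times
      borel_measurable_const measurable_iid_entries_component[OF \<nu>]) auto

text \<open>Monotonicity of the measure in the final inclusion of the union bound requires the
  larger event, this one, to be measurable.\<close>

lemma pred_cv_bounds:
  fixes \<epsilon> :: real
  assumes \<nu>: "sets \<nu> = sets borel"
    and x: "x \<in> carrier_vec N" and xhat: "\<forall>j\<in>{1..p}. xhat j \<in> carrier_vec N"
  shows "Measurable.pred (iid_entries r N \<nu>) (\<lambda>\<omega>. cv_bounds \<epsilon> (mat r N \<omega>) p x xhat)"
proof -
  have [measurable]: "(\<lambda>\<omega>. l2norm (mat r N \<omega> *\<^sub>v x)) \<in> borel_measurable (iid_entries r N \<nu>)"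
    by (rule measurable_l2norm_mat_mult_vec[OF \<nu> x])
  have [measurable]: "(\<lambda>\<omega>. l2norm (mat r N \<omega> *\<^sub>v (x - xhat j))) \<in> borel_measurable (iid_entries r N \<nu>)"
    if "j \<in> {1..p}" for j
    using that x xhat by (intro measurable_l2norm_mat_mult_vec[OF \<nu>]) auto
  show ?thesis
    unfolding cv_bounds_def ratio_between_def eta_cv_def by measurable
qed

lemma pred_nearly_isometric_at:
  assumes \<nu>: "sets \<nu> = sets borel" and v: "v \<in> carrier_vec N"
  shows "Measurable.pred (iid_entries r N \<nu>) (\<lambda>\<omega>. nearly_isometric_at \<epsilon> (mat r N \<omega>) v)"
proof -
  note [measurable] = measurable_l2norm_mat_mult_vec[OF \<nu> v]
  show ?thesis unfolding nearly_isometric_at_def by measurable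
qed

lemma prob_cv_bounds_ge:
  fixes \<epsilon> :: real
  assumes \<nu>: "prob_space \<nu>" "sets \<nu> = sets borel" "strict_subgaussian (1 / real r) \<nu> (\<lambda>x. x)"
    and r: "0 < r" and \<epsilon>: "0 < \<epsilon>" "\<epsilon> < 1" and p: "1 \<le> p"
    and x: "x \<in> carrier_vec N" and xhat: "\<forall>j\<in>{1..p}. xhat j \<in> carrier_vec N"
  shows "\<P>(\<omega> in iid_entries r N \<nu>. cv_bounds \<epsilon> (mat r N \<omega>) p x xhat)
    \<ge> 1 - 4 * real p * exp (- (real r * \<epsilon>\<^sup>2 / 512))"
proof -
  let ?M = "iid_entries r N \<nu>"
  interpret prob_space ?M
    by (rule prob_space_iid_entries[OF \<nu>(1)])
  \<comment> \<open>As a set, \<open>V\<close> counts coinciding vectors once; only an upper bound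
    on its size matters.\<close>
  define V where "V = insert x ((\<lambda>j. x - xhat j) ` {1..p})"
  define B where "B v = {\<omega> \<in> space ?M. \<not> nearly_isometric_at \<epsilon> (mat r N \<omega>) v}" for v
  have V: "finite V" "V \<subseteq> carrier_vec N"
    using x xhat by (auto simp: V_def)
  have "card V \<le> Suc (card ((\<lambda>j. x - xhat j) ` {1..p}))"
    unfolding V_def by (rule card_insert_le_m1) auto
  also have "\<dots> \<le> Suc p"
    using card_image_le[of "{1..p}" "\<lambda>j. x - xhat j"] by simp
  \<comment> \<open>Replacing \<open>p + 1\<close> by \<open>2 * p\<close> makes the failure bound
    proportional to \<open>p\<close>, matching the quotient inside the logarithm.\<close>
  finally have card_V: "card V \<le> 2 * p" using p by simp
  have B: "B v \<in> events" if "v \<in> V" for v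
    using pred_nearly_isometric_at[OF \<nu>(2), where v = v and N = N and r = r and \<epsilon> = \<epsilon>] V that unfolding B_def by auto
  have G: "{\<omega> \<in> space ?M. cv_bounds \<epsilon> (mat r N \<omega>) p x xhat} \<in> events"
    using pred_cv_bounds[OF \<nu>(2) x xhat, where r = r and \<epsilon> = \<epsilon>] by simp
  have "prob (\<Union>v\<in>V. B v) \<le> (\<Sum>v\<in>V. prob (B v))"
    using V(1) B by (intro finite_measure_subadditive_finite) auto
  also have "\<dots> \<le> (\<Sum>v\<in>V. 2 * exp (- (real r * \<epsilon>\<^sup>2 / 512)))"
    unfolding B_def using \<epsilon> V by (intro sum_mono prob_not_nearly_isometric_le[OF \<nu> r]) auto
  also have "\<dots> = real (card V) * (2 * exp (- (real r * \<epsilon>\<^sup>2 / 512)))" by simp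
  also have "\<dots> \<le> real (2 * p) * (2 * exp (- (real r * \<epsilon>\<^sup>2 / 512)))"
    using card_V by (intro mult_right_mono) auto
  finally have "prob (\<Union>v\<in>V. B v) \<le> 4 * real p * exp (- (real r * \<epsilon>\<^sup>2 / 512))" by simp
  moreover have "prob (space ?M - (\<Union>v\<in>V. B v)) = 1 - prob (\<Union>v\<in>V. B v)"
    using V(1) B by (intro prob_compl) auto
  moreover have "prob (space ?M - (\<Union>v\<in>V. B v)) \<le> prob {\<omega> \<in> space ?M. cv_bounds \<epsilon> (mat r N \<omega>) p x xhat}"
    using G by (rule finite_measure_mono[rotated])
      (auto simp: B_def V_def intro!: cv_bounds_if_nearly_isometric[OF \<epsilon> p x xhat])
  ultimately show ?thesis by linarith
qed

section \<open>Choice of the number of rows\<close>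

text \<open>\<open>C\<close> depends on \<open>\<kappa>\<close> alone and serves both entry laws.
  Keeping \<open>p / (2 * \<xi>)\<close> away from 1 bounds its logarithm below by
  \<open>ln \<kappa> > 0\<close>; for a quotient at most 1 the formula would allot no rows at
  all.\<close>

theorem theorem3p5p1:
  fixes \<kappa> :: real
  assumes "\<kappa> > 1"
  shows "\<exists>C>0. \<forall>(N::nat) (p::nat) (\<epsilon>::real) (\<xi>::real) (x::real vec) (xhat::nat \<Rightarrow> real vec) (r::nat).
     0 < \<epsilon> \<longrightarrow> \<epsilon> \<le> 1 / 2 \<longrightarrow> 0 < \<xi> \<longrightarrow> \<xi> < 1 \<longrightarrow> 1 \<le> p \<longrightarrow>
     \<kappa> \<le> real p / (2 * \<xi>) \<longrightarrow>
     x \<in> carrier_vec N \<longrightarrow> (\<forall>j\<in>{1..p}. xhat j \<in> carrier_vec N) \<longrightarrow>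
     r = nat \<lceil>C * (1 / \<epsilon>\<^sup>2) * ln (real p / (2 * \<xi>))\<rceil> \<longrightarrow>
     (\<forall>\<nu>\<in>{gaussian_entry r, bernoulli_entry r}.
        \<P>(\<omega> in iid_entries r N \<nu>. cv_bounds \<epsilon> (mat r N \<omega>) p x xhat) \<ge> 1 - \<xi>)"
proof -
  define C where "C = 512 * (1 + ln 8 / ln \<kappa>)"
  have ln\<kappa>: "0 < ln \<kappa>" using assms by simp
  have C: "0 < C" unfolding C_def using ln\<kappa> by (simp add: add_pos_nonneg)
  show ?thesis
  proof (intro exI[of _ C] conjI C allI impI ballI)
    fix N p :: nat and \<epsilon> \<xi> :: real and x :: "real vec" and xhat :: "nat \<Rightarrow> real vec"
      and r :: nat and \<nu> :: "real measure"
    assume \<epsilon>: "0 < \<epsilon>" "\<epsilon> \<le> 1 / 2" and \<xi>: "0 < \<xi>" and p: "1 \<le> p"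
      and L: "\<kappa> \<le> real p / (2 * \<xi>)"
      and x: "x \<in> carrier_vec N" and xhat: "\<forall>j\<in>{1..p}. xhat j \<in> carrier_vec N"
      and r: "r = nat \<lceil>C * (1 / \<epsilon>\<^sup>2) * ln (real p / (2 * \<xi>))\<rceil>"
      and \<nu>: "\<nu> \<in> {gaussian_entry r, bernoulli_entry r}"
    define L where "L = real p / (2 * \<xi>)"
    have lnL: "ln \<kappa> \<le> ln L" using assms L by (simp add: L_def)
    have Lpos: "0 < L" using p \<xi> by (simp add: L_def)
    \<comment> \<open>Positivity before rounding ensures at least one row and makes the conversion
      by \<open>nat\<close> harmless.\<close>
    have "0 < C * (1 / \<epsilon>\<^sup>2) * ln L" using C \<epsilon> ln\<kappa> lnL by simp
    then have r_pos: "0 < r" and r_ge: "C * (1 / \<epsilon>\<^sup>2) * ln L \<le> r"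
      unfolding r L_def[symmetric] by (simp, linarith)
    have "C * (1 / \<epsilon>\<^sup>2) * ln L * \<epsilon>\<^sup>2 \<le> r * \<epsilon>\<^sup>2"
      using r_ge by (rule mult_right_mono) simp
    then have "C * ln L \<le> r * \<epsilon>\<^sup>2" using \<epsilon> by simp
    moreover have "512 * (ln L + ln 8) \<le> C * ln L"
    proof -
      have "ln 8 * ln \<kappa> \<le> ln 8 * ln L" using lnL by (intro mult_left_mono) auto
      then have "ln 8 \<le> ln 8 / ln \<kappa> * ln L" using ln\<kappa> by (simp add: field_simps)
      then have "512 * (ln L + ln 8) \<le> 512 * (ln L + ln 8 / ln \<kappa> * ln L)" by (intro mult_left_mono add_left_mono) auto
      also have "\<dots> = C * ln L" by (simp add: C_def algebra_simps)
      finally show ?thesis .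
    qed
    ultimately have "- (real r * \<epsilon>\<^sup>2 / 512) \<le> - ln (8 * L)"
      using Lpos by (simp add: ln_mult)
    then have "exp (- (real r * \<epsilon>\<^sup>2 / 512)) \<le> exp (- ln (8 * L))" by simp
    also have "\<dots> = 1 / (8 * L)"
      using Lpos by (simp add: exp_minus inverse_eq_divide)
    finally have "4 * real p * exp (- (real r * \<epsilon>\<^sup>2 / 512)) \<le> 4 * real p * (1 / (8 * L))"
      by (intro mult_left_mono) auto
    \<comment> \<open>Here \<open>4 * p = 8 * L * \<xi>\<close>, which is the origin of the 8 in
      \<open>C\<close>.\<close>
    also have "\<dots> = \<xi>" using p \<xi> by (simp add: L_def)
    finally have small: "4 * real p * exp (- (real r * \<epsilon>\<^sup>2 / 512)) \<le> \<xi>" .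
    have "prob_space \<nu>" "sets \<nu> = sets borel" "strict_subgaussian (1 / real r) \<nu> (\<lambda>x. x)"
      using \<nu> r_pos prob_space_gaussian_entry prob_space_bernoulli_entry
        sets_gaussian_entry sets_bernoulli_entry
        strict_subgaussian_gaussian_entry strict_subgaussian_bernoulli_entry by auto
    from prob_cv_bounds_ge[OF this r_pos _ _ p x xhat, of \<epsilon>] \<epsilon> small
    show "\<P>(\<omega> in iid_entries r N \<nu>. cv_bounds \<epsilon> (mat r N \<omega>) p x xhat) \<ge> 1 - \<xi>"
      by simp
  qed
qed

end
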